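(* Let $\mathbf{i}=(i_1,\ldots,i_r)\in\mathbf{I}_r$, $\mathbf{j}=(j_1,\ldots,j_r)\in\mathbf{J}_r$, and let $\{j_{r+1},\ldots,j_n\}=\{1,\ldots,n\}\setminus\{j_1,\ldots,j_r\}$. Then: 1. $\mathrm{Der}_K(A)$ is the set of all $\Delta(\mathbf{i},\mathbf{j})^{-1}\sum_{k=r+1}^{n}a_{j_k}\,\partial_{i_1,\ldots,i_r;j_1,\ldots,j_r,j_k}$ where the elements $a_{j_{r+1}},\ldots,a_{j_n}\in A$ satisfy the system of inclusions $$\sum_{k=r+1}^{n}\Delta(\mathbf{i};j_1,\ldots,j_{\nu-1},j_k,j_{\nu+1},\ldots,j_r)\,a_{j_k}\in A\,\Delta(\mathbf{i},\mathbf{j}),\qquad \nu=1,\ldots,r.$$ 2. $\mathrm{Der}_K(A)$ is the set of all $$\sum_{k=r+1}^{n}a_{j_k}\partial_{j_k}-\Delta(\mathbf{i},\mathbf{j})^{-1}\sum_{\nu=1}^{r}\Delta_{\mathbf{i},j_\nu}\Big(\sum_{k=r+1}^{n}a_{j_k}v_{\mathbf{i},j_k}\Big)\partial_{j_\nu}$$ where the elements $a_{j_{r+1}},\ldots,a_{j_n}\in A$ satisfy the system of inclusions $$\Delta(\mathbf{i},\mathbf{j})^{-1}\Delta_{\mathbf{i},j_\nu}\Big(\sum_{k=r+1}^{n}a_{j_k}v_{\mathbf{i},j_k}\Big)\in A,\qquad \nu=1,\ldots,r.$$ The geometric meaning of these inclusions (in both statements) is that all the coordinates of the vector $\sum_{k=r+1}^{n}a_{j_k}v_{\mathbf{i},j_k}\in\bigoplus_{\nu=1}^{r}Qv_{\mathbf{i},j_\nu}$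 in the basis $v_{\mathbf{i},j_1},\ldots,v_{\mathbf{i},j_r}$ belong to $A$.
   Context: $K$ is a field of characteristic zero, $P_n=K[x_1,\ldots,x_n]$, $I=\sum_{i=1}^m P_nf_i$ is a prime but not maximal ideal of $P_n$ with generators $f_1,\ldots,f_m$, and $A=P_n/I$ (not assumed regular), a domain with field of fractions $Q$. The image of $p\in P_n$ in $A$ is written $\overline{p}$. $\overline{J}=\left(\overline{\partial f_i/\partial x_j}\right)\in M_{m,n}(A)$ is the Jacobi matrix and $r$ is its rank over $Q$. For tuples $\mathbf{i}=(i_1,\ldots,i_r)$ of indices in $\{1,\ldots,m\}$ and $\mathbf{j}=(j_1,\ldots,j_r)$ of indices in $\{1,\ldots,n\}$, $\Delta(\mathbf{i},\mathbf{j})=\Delta(\mathbf{i};j_1,\ldots,j_r)=\det(\overline{J}_{i_\nu,j_\mu})_{\nu,\mu=1,\ldots,r}$ (columns in the listed order). A strictly increasing $\mathbf{i}$ (resp. $\mathbf{j}$) is non-singular if $\Delta(\mathbf{i},\mathbf{j}')\ne0$ for some $\mathbf{j}'$ (resp. $\Delta(\mathbf{i}',\mathbf{j})\neq0$ for some $\mathbf{i}'$); $\mathbf{I}_r$ (resp. $\mathbf{J}_r$) is the set of non-singular strictly increasing $r$-tuples $\mathbf{i}$ (resp. $\mathbf{j}$). If $\mathbf{i}\in\mathbf{I}_r$ and $\mathbf{j}\in\mathbf{J}_r$ then $\Delta(\mathbf{i},\mathbf{j})\ne0$. Derivations of $A$ are identified with expressions $\sum_{i=1}^n a_i\partial_i\in\bigoplus_{i=1}^nA\partial_i$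 ($\partial_i=\partial/\partial x_i$) such that $\overline{J}(a_1,\ldots,a_n)^T=0$; the derivation sends $\overline{x}_i\mapsto a_i$. Derivations of $Q$ are written similarly with $a_i\in Q$, and $\mathrm{Der}_K(A)\subseteq\mathrm{Der}_K(Q)$. For indices $j_1,\ldots,j_{r+1}$ (not necessarily increasing), $\partial_{\mathbf{i};j_1,\ldots,j_{r+1}}=\sum_{k=1}^{r+1}(-1)^{r+1+k}\Delta(\mathbf{i};j_1,\ldots,\widehat{j_k},\ldots,j_{r+1})\,\partial_{j_k}\in\mathrm{Der}_K(A)$ (hat means omitted). For $j=1,\ldots,n$, $v_{\mathbf{i},j}=\left(\overline{\partial f_{i_1}/\partial x_j},\ldots,\overline{\partial f_{i_r}/\partial x_j}\right)^T\in Q^r$; for $\mathbf{i}\in\mathbf{I}_r,\mathbf{j}\in\mathbf{J}_r$ the vectors $v_{\mathbf{i},j_1},\ldots,v_{\mathbf{i},j_r}$ form a basis of $Q^r$. $\Delta_{\mathbf{i},j_\nu}:Q^r\to Q$ is the $Q$-linear map sending $q$ to the determinant of the $r\times r$ matrix with columns $v_{\mathbf{i},j_1},\ldots,v_{\mathbf{i},j_{\nu-1}},q,v_{\mathbf{i},j_{\nu+1}},\ldots,v_{\mathbf{i},j_r}$. *)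

theory Defs
  imports
    "HOL-Library.Poly_Mapping"
    "HOL-Algebra.QuotRing"
    "Jordan_Normal_Form.Determinant"
    "Jordan_Normal_Form.DL_Rank"
begin

text \<open>
  Everything is indexed from 0: the variables of \<open>P\<^sub>n\<close> are \<open>x\<^sub>0, \<dots>, x\<^bsub>n-1\<^esub>\<close>, the generators of the ideal
  are \<open>f\<^sub>0, \<dots>, f\<^bsub>m-1\<^esub>\<close>, and positions in index tuples (lists of natural numbers) start at 0.
\<close>

text \<open>A polynomial is a finitely supported map from exponent vectors to coefficients.\<close>

type_synonym 'k mpol = "(nat \<Rightarrow>\<^sub>0 nat) \<Rightarrow>\<^sub>0 'k"

definition Const :: "'k::comm_ring_1 \<Rightarrow> 'k mpol" where
  "Const c = Poly_Mapping.single 0 c"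

definition Var :: "nat \<Rightarrow> 'k::comm_ring_1 mpol" where
  "Var j = Poly_Mapping.single (Poly_Mapping.single j 1) 1"

definition poly_ring :: "nat \<Rightarrow> 'k::comm_ring_1 mpol ring" where
  "poly_ring n =
    \<lparr>carrier = {p. \<forall>t \<in> Poly_Mapping.keys p. Poly_Mapping.keys t \<subseteq> {..<n}},
     monoid.mult = (*), one = 1, zero = 0, add = (+)\<rparr>"

text \<open>
  Terms with exponent 0 at \<open>x\<^sub>j\<close> get the coefficient 0, so truncated subtraction of exponents is
  harmless.
\<close>

definition pdiff :: "nat \<Rightarrow> 'k::comm_ring_1 mpol \<Rightarrow> 'k mpol" where
  "pdiff j p =
    (\<Sum>t \<in> Poly_Mapping.keys p.
      Poly_Mapping.single (t - Poly_Mapping.single j 1)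
        (of_nat (Poly_Mapping.lookup t j) * Poly_Mapping.lookup p t))"

text \<open>
  The type \<open>'q\<close>, a field, is a field of fractions of the ring \<open>A\<close> via the embedding \<open>\<iota>\<close>.
\<close>

definition is_fraction_field :: "('a, 'b) ring_scheme \<Rightarrow> ('a \<Rightarrow> 'q::field) \<Rightarrow> bool" where
  "is_fraction_field A \<iota> \<longleftrightarrow>
    \<iota> \<in> Ring.ring_hom A class_ring \<and> inj_on \<iota> (carrier A) \<and>
    (\<forall>q. \<exists>a \<in> carrier A. \<exists>b \<in> carrier A. \<iota> b \<noteq> 0 \<and> q = \<iota> a / \<iota> b)"

text \<open>
  \<open>Der\<^sub>K(A)\<close>, where \<open>\<kappa>\<close> is the structure map from \<open>K\<close> to \<open>A\<close>. Derivations are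
  extensional functions, so that distinct elements of this set differ on \<open>A\<close>.
\<close>

definition derivations :: "('k \<Rightarrow> 'a) \<Rightarrow> ('a, 'b) ring_scheme \<Rightarrow> ('a \<Rightarrow> 'a) set" where
  "derivations \<kappa> A =
    {D \<in> carrier A \<rightarrow>\<^sub>E carrier A.
      (\<forall>x \<in> carrier A. \<forall>y \<in> carrier A. D (x \<oplus>\<^bsub>A\<^esub> y) = D x \<oplus>\<^bsub>A\<^esub> D y) \<and>
      (\<forall>c. \<forall>x \<in> carrier A. D (\<kappa> c \<otimes>\<^bsub>A\<^esub> x) = \<kappa> c \<otimes>\<^bsub>A\<^esub> D x) \<and>
      (\<forall>x \<in> carrier A. \<forall>y \<in> carrier A.
        D (x \<otimes>\<^bsub>A\<^esub> y) = (D x \<otimes>\<^bsub>A\<^esub> y) \<oplus>\<^bsub>A\<^esub> (x \<otimes>\<^bsub>A\<^esub> D y))}"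

text \<open>
  An expression \<open>\<Sum>\<^sub>j q\<^sub>j \<partial>\<^sub>j\<close> with \<open>q\<^sub>j \<in> Q\<close> is the vector \<open>(q\<^sub>0, \<dots>, q\<^bsub>n-1\<^esub>)\<close>; in particular \<open>\<partial>\<^sub>j\<close> is
  the unit vector \<open>unit_vec n j\<close>. A derivation \<open>D\<close> of \<open>A = P\<^sub>n / I\<close> is identified with the expression
  whose \<open>j\<close>-th coefficient is the value of \<open>D\<close> at the class of \<open>x\<^sub>j\<close>.
\<close>

definition der_expr ::
  "nat \<Rightarrow> 'k::comm_ring_1 mpol set \<Rightarrow> ('k mpol set \<Rightarrow> 'q) \<Rightarrow> ('k mpol set \<Rightarrow> 'k mpol set) \<Rightarrow> 'q vec"
where
  "der_expr n I \<iota> D = vec n (\<lambda>j. \<iota> (D (I +>\<^bsub>poly_ring n\<^esub> Var j)))"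

text \<open>
  The Jacobi matrix of \<open>f\<^sub>0, \<dots>, f\<^bsub>m-1\<^esub>\<close> modulo \<open>I\<close>, with its entries regarded as elements of \<open>Q\<close>.
\<close>

definition jacobi ::
  "nat \<Rightarrow> nat \<Rightarrow> 'k::comm_ring_1 mpol set \<Rightarrow> ('k mpol set \<Rightarrow> 'q) \<Rightarrow> (nat \<Rightarrow> 'k mpol) \<Rightarrow> 'q mat"
where
  "jacobi m n I \<iota> f = mat m n (\<lambda>(i, j). \<iota> (I +>\<^bsub>poly_ring n\<^esub> pdiff j (f i)))"

text \<open>
  In the definitions below \<open>J\<close> is the Jacobi matrix and \<open>i\<close>, \<open>j\<close> are tuples of row and column indices.
\<close>

definition minor :: "'q::comm_ring_1 mat \<Rightarrow> nat list \<Rightarrow> nat list \<Rightarrow> 'q" where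
  "minor J i j = det (mat (length i) (length i) (\<lambda>(\<nu>, \<mu>). J $$ (i ! \<nu>, j ! \<mu>)))"

definition index_tuples :: "nat \<Rightarrow> nat \<Rightarrow> nat list set" where
  "index_tuples r k = {i. length i = r \<and> set i \<subseteq> {..<k}}"

definition nonsing_rows :: "'q::comm_ring_1 mat \<Rightarrow> nat \<Rightarrow> nat list set" where
  "nonsing_rows J r =
    {i \<in> index_tuples r (dim_row J). sorted_wrt (<) i \<and>
      (\<exists>j' \<in> index_tuples r (dim_col J). minor J i j' \<noteq> 0)}"

definition nonsing_cols :: "'q::comm_ring_1 mat \<Rightarrow> nat \<Rightarrow> nat list set" where
  "nonsing_cols J r =
    {j \<in> index_tuples r (dim_col J). sorted_wrt (<) j \<and>
      (\<exists>i' \<in> index_tuples r (dim_row J). minor J i' j \<noteq> 0)}"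

text \<open>
  The derivation \<open>\<partial>\<close> attached to a tuple \<open>i\<close> of length \<open>r\<close> and a tuple \<open>j\<close> of length \<open>r + 1\<close>.
  The sign at position \<open>k\<close> (counted from 0) is \<open>(-1)\<close> to the power \<open>r + 1 + (k + 1)\<close>, that is, to the
  power \<open>r + k\<close>.
\<close>

definition minor_der :: "'q::comm_ring_1 mat \<Rightarrow> nat list \<Rightarrow> nat list \<Rightarrow> 'q vec" where
  "minor_der J i j =
    finsum_vec TYPE('q) (dim_col J)
      (\<lambda>k. ((- 1) ^ (length i + k) * minor J i (take k j @ drop (Suc k) j)) \<cdot>\<^sub>v
        unit_vec (dim_col J) (j ! k))
      {..<length j}"

definition col_vec :: "'q mat \<Rightarrow> nat list \<Rightarrow> nat \<Rightarrow> 'q vec" where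
  "col_vec J i l = vec (length i) (\<lambda>\<nu>. J $$ (i ! \<nu>, l))"

text \<open>The linear form on \<open>Q\<^sup>r\<close> which puts \<open>q\<close> in place of the column at position \<open>\<nu>\<close> of \<open>j\<close>.\<close>

definition col_form :: "'q::comm_ring_1 mat \<Rightarrow> nat list \<Rightarrow> nat list \<Rightarrow> nat \<Rightarrow> 'q vec \<Rightarrow> 'q" where
  "col_form J i j \<nu> q =
    det (replace_col (mat_of_cols (length i) (map (col_vec J i) j)) q \<nu>)"

end

theory Submission
  imports Defs
begin

text \<open>
  The chain rule identifies the derivations of \<open>A = P\<^sub>n / I\<close> with the vectors over \<open>A\<close> in the kernel of
  the Jacobi matrix \<open>J\<close>. A rank factorization \<open>J = B C\<close> through \<open>Q\<^sup>r\<close> turns every \<open>r \<times> r\<close> minor of \<open>J\<close>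
  into a product of a minor of \<open>B\<close> and a minor of \<open>C\<close>, so \<open>\<Delta>(i, j) \<noteq> 0\<close> and the rows \<open>i\<close> alone already cut
  out the kernel. Cramer's rule then expresses the coefficients at the pivot columns \<open>j\<close> by those at
  the other columns, which gives the second description; the first one has the same coefficients
  because moving a column to the end of a minor only changes its sign.
\<close>

section \<open>Rank factorization and its consequences for minors and kernels\<close>

subsection \<open>Linear algebra\<close>

text \<open>The columns of \<open>B\<close> are a maximal independent set of columns of
  \<open>A\<close>, and \<open>C\<close> records the coordinates of all columns of \<open>A\<close>
  in that basis of the column space. An inner dimension equal to the rank is what makes minors of
  this size multiplicative below.\<close>

lemma (in vec_space) rank_factorization:
  assumes A: "A \<in> carrier_mat n nc"
  obtains B C where "B \<in> carrier_mat n (rank A)" "C \<in> carrier_mat (rank A) nc" "A = B * C"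
proof -
  let ?P = "\<lambda>T. T \<subseteq> set (cols A) \<and> lin_indpt T"
  have cols: "set (cols A) \<subseteq> carrier_vec n" using cols_dim A by blast
  have "?P {}" using finite_lin_indpt2[of "{}"] by auto
  then obtain S where S: "finite S" "maximal S ?P"
    using maximal_exists_superset[of "set (cols A)" ?P "{}"] by auto
  have S': "S \<subseteq> set (cols A)" "lin_indpt S" using S(2) unfolding maximal_def by auto
  have rank: "rank A = card S" by (rule rank_card_indpt[OF A S(2)])
  have SC: "S \<subseteq> carrier_vec n" using S' cols by auto
  have span: "c \<in> span S" if c: "c \<in> set (cols A)" for c
  \<comment> \<open>A column outside the span could be adjoined to \<open>S\<close> without losing
    independence, against maximality.\<close>
  proof (rule ccontr)
    assume n: "c \<notin> span S"
    have cc: "c \<in> carrier_vec n" using c cols by auto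
    have cS: "c \<notin> S" using n span_mem[of S c] SC by auto
    have "lin_indpt (S \<union> {c})"
      using lin_dep_iff_in_span[of S c] SC S' cc cS n by auto
    then have "?P (S \<union> {c})" using S' c by auto
    then have "S \<union> {c} = S" using S(2) unfolding maximal_def by blast
    then show False using cS by auto
  qed
  obtain bs where bs: "set bs = S" "distinct bs" using finite_distinct_list[OF S(1)] by auto
  have len: "length bs = rank A" using rank bs distinct_card by metis
  have ex: "\<exists>x. x \<in> carrier_vec (rank A) \<and> col A l = mat_of_cols n bs *\<^sub>v x" if l: "l < nc" for l
  proof -
    have "col A l \<in> set (cols A)" using l A by (auto simp: cols_def)
    then have "col A l \<in> span_list bs"
      using span span_list_as_span[of bs] bs SC by auto
    then obtain c where "col A l = lincomb_list c bs" by (rule in_span_listE)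
    also have "\<dots> = mat_of_cols n bs *\<^sub>v vec (length bs) c"
      using bs SC by (intro lincomb_list_as_mat_mult) auto
    finally show ?thesis using len by (intro exI[of _ "vec (length bs) c"]) auto
  qed
  then obtain x where x: "\<And>l. l < nc \<Longrightarrow> x l \<in> carrier_vec (rank A)"
    "\<And>l. l < nc \<Longrightarrow> col A l = mat_of_cols n bs *\<^sub>v x l" by metis
  let ?B = "mat_of_cols n bs" and ?C = "mat_of_cols (rank A) (map x [0..<nc])"
  have "A = ?B * ?C"
  proof (rule eq_matI)
    fix a b assume "a < dim_row (?B * ?C)" "b < dim_col (?B * ?C)"
    then have ab: "a < n" "b < nc" by auto
    have "A $$ (a, b) = col A b $ a" using ab A by auto
    also have "\<dots> = row ?B a \<bullet> x b" using ab x by simp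
    also have "\<dots> = (?B * ?C) $$ (a, b)"
      using ab x(1)[OF ab(2)] by (simp add: col_mat_of_cols)
    finally show "A $$ (a, b) = (?B * ?C) $$ (a, b)" .
  qed (use A in auto)
  moreover have "?B \<in> carrier_mat n (rank A)" using len by auto
  moreover have "?C \<in> carrier_mat (rank A) nc" by auto
  ultimately show thesis using that by blast
qed

text \<open>This is the Cauchy-Binet formula with a single term: as the inner dimension is
  \<open>r\<close>, the chosen submatrix of \<open>B * C\<close> is itself a product of two square
  matrices.\<close>

lemma minor_mult:
  assumes B: "B \<in> carrier_mat m r" and C: "C \<in> carrier_mat r n"
    and i: "i \<in> index_tuples r m" and j: "j \<in> index_tuples r n"
  shows "minor (B * C) i j = minor B i [0..<r] * minor C [0..<r] j"
proof -
  have li: "length i = r" and im: "\<And>a. a < r \<Longrightarrow> i ! a < m"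
    using i nth_mem by (fastforce simp: index_tuples_def)+
  have lj: "length j = r" and jn: "\<And>a. a < r \<Longrightarrow> j ! a < n"
    using j nth_mem by (fastforce simp: index_tuples_def)+
  let ?B = "mat r r (\<lambda>(\<nu>, \<mu>). B $$ (i ! \<nu>, [0..<r] ! \<mu>))"
  let ?C = "mat r r (\<lambda>(\<nu>, \<mu>). C $$ ([0..<r] ! \<nu>, j ! \<mu>))"
  have "mat r r (\<lambda>(\<nu>, \<mu>). (B * C) $$ (i ! \<nu>, j ! \<mu>)) = ?B * ?C"
    using B C im jn by (intro eq_matI) (auto simp: scalar_prod_def)
  then show ?thesis
    unfolding minor_def li by (simp add: det_mult[where n = r])
qed

text \<open>In a rank factorization, the witness columns for \<open>i\<close> show that rows
  \<open>i\<close> of \<open>B\<close> have nonzero determinant, and the witness rows for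
  \<open>j\<close> show the same for columns \<open>j\<close> of \<open>C\<close>. The wanted minor
  is the product of these two determinants.\<close>

lemma nonsing_minor_ne_0:
  fixes J :: "'q::field mat"
  assumes J: "J \<in> carrier_mat m n" and r: "r = vec_space.rank m J"
    and i: "i \<in> nonsing_rows J r" and j: "j \<in> nonsing_cols J r"
  shows "minor J i j \<noteq> 0"
proof -
  obtain B C where BC: "B \<in> carrier_mat m r" "C \<in> carrier_mat r n" "J = B * C"
    using vec_space.rank_factorization[OF J] r by metis
  have i': "i \<in> index_tuples r m" and j': "j \<in> index_tuples r n"
    using i j J by (auto simp: nonsing_rows_def nonsing_cols_def)
  obtain k where k: "k \<in> index_tuples r n" "minor J i k \<noteq> 0"
    using i J by (auto simp: nonsing_rows_def)
  obtain l where l: "l \<in> index_tuples r m" "minor J l j \<noteq> 0"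
    using j J by (auto simp: nonsing_cols_def)
  show ?thesis
    using k l minor_mult[OF BC(1,2) i' k(1)] minor_mult[OF BC(1,2) l(1) j']
      minor_mult[OF BC(1,2) i' j'] BC(3) by simp
qed

lemma det_ne_0_mult_vec_eq_0:
  fixes M :: "'q::field mat"
  assumes M: "M \<in> carrier_mat r r" and d: "det M \<noteq> 0" and x: "x \<in> carrier_vec r"
    and 0: "M *\<^sub>v x = 0\<^sub>v r"
  shows "x = 0\<^sub>v r"
  using det_0_iff_vec_prod_zero_field[OF M] d x 0 by auto

text \<open>Write \<open>J *\<^sub>v v\<close> as \<open>B\<close> applied to
  \<open>C *\<^sub>v v\<close>. Rows \<open>i\<close> of \<open>B\<close> form an invertible matrix,
  so the equations of these rows already force \<open>C *\<^sub>v v\<close> to vanish, and with it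
  all rows.\<close>

lemma mult_vec_eq_0_iff_nonsing_rows:
  fixes J :: "'q::field mat"
  assumes J: "J \<in> carrier_mat m n" and r: "r = vec_space.rank m J"
    and i: "i \<in> nonsing_rows J r" and v: "v \<in> carrier_vec n"
  shows "J *\<^sub>v v = 0\<^sub>v m \<longleftrightarrow> (\<forall>\<nu><r. (\<Sum>l<n. J $$ (i ! \<nu>, l) * v $ l) = 0)"
proof
  have i': "i \<in> index_tuples r m" using i J by (auto simp: nonsing_rows_def)
  have li: "length i = r" and im: "\<And>a. a < r \<Longrightarrow> i ! a < m"
    using i' nth_mem by (fastforce simp: index_tuples_def)+
  have sum: "(\<Sum>l<n. J $$ (s, l) * v $ l) = (J *\<^sub>v v) $ s" if "s < m" for s
    using that J v by (auto simp: scalar_prod_def lessThan_atLeast0)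
  show "\<forall>\<nu><r. (\<Sum>l<n. J $$ (i ! \<nu>, l) * v $ l) = 0" if "J *\<^sub>v v = 0\<^sub>v m"
    using sum im that by auto
  assume 0: "\<forall>\<nu><r. (\<Sum>l<n. J $$ (i ! \<nu>, l) * v $ l) = 0"
  obtain B C where BC: "B \<in> carrier_mat m r" "C \<in> carrier_mat r n" "J = B * C"
    using vec_space.rank_factorization[OF J] r by metis
  obtain k where k: "k \<in> index_tuples r n" "minor J i k \<noteq> 0"
    using i J by (auto simp: nonsing_rows_def)
  let ?B = "mat r r (\<lambda>(\<nu>, \<mu>). B $$ (i ! \<nu>, [0..<r] ! \<mu>))"
  have "det ?B \<noteq> 0"
    using k(2) minor_mult[OF BC(1,2) i' k(1)] BC(3) li by (auto simp: minor_def)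
  have Jv: "J *\<^sub>v v = B *\<^sub>v (C *\<^sub>v v)" using BC v by simp
  have "?B *\<^sub>v (C *\<^sub>v v) = 0\<^sub>v r"
  proof (rule eq_vecI)
    fix \<nu> assume "\<nu> < dim_vec (0\<^sub>v r :: 'q vec)"
    then have \<nu>: "\<nu> < r" by simp
    have "(?B *\<^sub>v (C *\<^sub>v v)) $ \<nu> = (B *\<^sub>v (C *\<^sub>v v)) $ (i ! \<nu>)"
      using \<nu> BC im[OF \<nu>] by (auto simp: scalar_prod_def)
    also have "\<dots> = 0" using 0 \<nu> sum[OF im[OF \<nu>]] Jv by simp
    finally show "(?B *\<^sub>v (C *\<^sub>v v)) $ \<nu> = 0\<^sub>v r $ \<nu>" using \<nu> by simp
  qed simp
  then have "C *\<^sub>v v = 0\<^sub>v r"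
    using det_ne_0_mult_vec_eq_0[OF _ \<open>det ?B \<noteq> 0\<close>] BC v by auto
  then show "J *\<^sub>v v = 0\<^sub>v m" using Jv BC(1) by (intro eq_vecI) auto
qed

section \<open>Determinants with one column replaced, and Cramer's rule\<close>

definition col_mat :: "'q mat \<Rightarrow> nat list \<Rightarrow> nat list \<Rightarrow> 'q mat" where
  "col_mat J i j = mat_of_cols (length i) (map (col_vec J i) j)"

lemma dim_col_mat [simp]: "dim_row (col_mat J i j) = length i" "dim_col (col_mat J i j) = length j"
  by (simp_all add: col_mat_def)

lemma col_mat_carrier: "length i = r \<Longrightarrow> length j = r \<Longrightarrow> col_mat J i j \<in> carrier_mat r r"
  by (auto simp: col_mat_def)

lemma col_mat_index:
  "s < length i \<Longrightarrow> \<nu> < length j \<Longrightarrow> col_mat J i j $$ (s, \<nu>) = J $$ (i ! s, j ! \<nu>)"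
  by (simp add: col_mat_def mat_of_cols_index col_vec_def)

lemma minor_eq_det_col_mat: "length j = length i \<Longrightarrow> minor J i j = det (col_mat J i j)"
  unfolding minor_def by (rule arg_cong[of _ _ det], rule eq_matI) (auto simp: col_mat_index)

text \<open>Here \<open>col_mat\<close>, assembled by columns as in \<open>col_form\<close>, pays
  off: replacing a column amounts to a list update of the index tuple.\<close>

lemma replace_col_mat_update:
  assumes "length i = r" "length j = r"
  shows "replace_col (col_mat J i j) (col_vec J i k) \<nu> = col_mat J i (j[\<nu> := k])"
  using assms
  by (intro eq_matI) (auto simp: replace_col_def col_mat_index nth_list_update col_vec_def)

text \<open>This is the link between the two systems of inclusions: the minors of the first one are
  the linear forms of the second one evaluated at single columns.\<close>

lemma minor_update_eq_col_form:
  "length j = length i \<Longrightarrow> minor J i (j[\<nu> := k]) = col_form J i j \<nu> (col_vec J i k)"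
  using replace_col_mat_update[of i "length i" j J k \<nu>]
  by (simp add: minor_eq_det_col_mat col_form_def col_mat_def)

text \<open>Laplace expansion along the replaced column, whose cofactors do not involve that column.
  The formula exhibits the linearity in \<open>q\<close>.\<close>

lemma col_form_eq_sum_cofactor:
  assumes "length i = r" "length j = r" "\<nu> < r"
  shows "col_form J i j \<nu> q = (\<Sum>s<r. q $ s * cofactor (col_mat J i j) s \<nu>)"
proof -
  let ?M = "replace_col (col_mat J i j) q \<nu>"
  have M: "?M \<in> carrier_mat r r" using assms by (auto simp: replace_col_def)
  have "col_form J i j \<nu> q = det ?M" by (simp add: col_form_def col_mat_def)
  also have "\<dots> = (\<Sum>s<r. ?M $$ (s, \<nu>) * cofactor ?M s \<nu>)"
    by (rule laplace_expansion_column[OF M assms(3)])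
  also have "\<dots> = (\<Sum>s<r. q $ s * cofactor (col_mat J i j) s \<nu>)"
  proof (rule sum.cong[OF refl])
    fix s assume "s \<in> {..<r}"
    have "mat_delete ?M s \<nu> = mat_delete (col_mat J i j) s \<nu>"
      using M assms by (intro eq_matI) (auto simp: mat_delete_def replace_col_def)
    then show "?M $$ (s, \<nu>) * cofactor ?M s \<nu> = q $ s * cofactor (col_mat J i j) s \<nu>"
      using \<open>s \<in> _\<close> M assms by (auto simp: cofactor_def replace_col_def)
  qed
  finally show ?thesis .
qed

text \<open>Column \<open>k\<close> has to pass \<open>r - 1 - \<nu>\<close> others. Expanding both
  determinants along it avoids permutations: deleting it leaves the same matrices, so only the
  cofactor signs differ.\<close>

lemma minor_move_last:
  assumes "length i = r" "length j = r" "\<nu> < r"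
  shows "minor J i (take \<nu> j @ drop (Suc \<nu>) j @ [k]) = (- 1) ^ (r - 1 - \<nu>) * minor J i (j[\<nu> := k])"
proof -
  let ?j = "take \<nu> j @ drop (Suc \<nu>) j @ [k]" and ?j' = "j[\<nu> := k]"
  let ?P = "col_mat J i ?j" and ?Q = "col_mat J i ?j'"
  have P: "?P \<in> carrier_mat r r" and Q: "?Q \<in> carrier_mat r r"
    using assms by (auto intro!: col_mat_carrier)
  have len: "length ?j = r" "length ?j' = r" using assms by auto
  have del: "mat_delete ?P s (r - 1) = mat_delete ?Q s \<nu>" if "s < r" for s
    using P Q assms that len
    by (intro eq_matI) (auto simp: mat_delete_def col_mat_index nth_append min_def nth_list_update)
  have sgn: "(- 1 :: 'a) ^ (s + (r - 1)) = (- 1) ^ (r - 1 - \<nu>) * (- 1) ^ (s + \<nu>)" for s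
    using assms(3) by (simp add: power_add[symmetric] add.commute)
  have "minor J i ?j = (\<Sum>s<r. ?P $$ (s, r - 1) * cofactor ?P s (r - 1))"
    using laplace_expansion_column[OF P, of "r - 1"] assms len by (simp add: minor_eq_det_col_mat)
  also have "\<dots> = (\<Sum>s<r. (- 1) ^ (r - 1 - \<nu>) * (?Q $$ (s, \<nu>) * cofactor ?Q s \<nu>))"
    using assms len del sgn
    by (intro sum.cong refl) (auto simp: cofactor_def col_mat_index nth_append min_def)
  also have "\<dots> = (- 1) ^ (r - 1 - \<nu>) * minor J i ?j'"
    using laplace_expansion_column[OF Q assms(3)] assms len
    by (simp add: minor_eq_det_col_mat sum_distrib_left)
  finally show ?thesis .
qed

text \<open>Omitting the entry of \<open>j\<close> at position \<open>a\<close> leaves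
  \<open>k\<close> at the end of the tuple; moving it back to position \<open>a\<close> turns the
  alternating signs of \<open>minor_der\<close> into a uniform minus sign.\<close>

lemma minor_der_snoc_index:
  fixes J :: "'q::comm_ring_1 mat"
  assumes li: "length i = r" and lj: "length j = r" and J: "J \<in> carrier_mat m n"
    and j: "set j \<subseteq> {..<n}" and k: "k < n" and l: "l < n"
  shows "minor_der J i (j @ [k]) $ l =
    minor J i j * of_bool (l = k) - (\<Sum>\<nu><r. minor J i (j[\<nu> := k]) * of_bool (l = j ! \<nu>))"
proof -
  let ?u = "\<lambda>a. unit_vec n ((j @ [k]) ! a) $ l"
  have "minor_der J i (j @ [k]) $ l = (\<Sum>a<Suc r. ((- 1) ^ (r + a) *
      minor J i (take a (j @ [k]) @ drop (Suc a) (j @ [k]))) * ?u a)"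
    using J l lj unfolding minor_der_def by (subst index_finsum_vec) (auto simp: li)
  \<comment> \<open>The summand \<open>a = r\<close> omits the new entry \<open>k\<close>, and its
    sign has the even exponent \<open>2 * r\<close>.\<close>
  also have "\<dots> = minor J i j * of_bool (l = k) +
     (\<Sum>a<r. ((- 1) ^ (r + a) * minor J i (take a (j @ [k]) @ drop (Suc a) (j @ [k]))) * ?u a)"
    using k l lj by (simp add: nth_append unit_vec_def)
  also have "(\<Sum>a<r. ((- 1) ^ (r + a) * minor J i (take a (j @ [k]) @ drop (Suc a) (j @ [k]))) * ?u a)
     = (\<Sum>a<r. - (minor J i (j[a := k]) * of_bool (l = j ! a)))"
  proof (rule sum.cong[OF refl])
    fix a assume "a \<in> {..<r}"
    then have a: "a < r" by simp
    \<comment> \<open>The sign of the definition and the sign of the move have total exponent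
      \<open>2 * r - 1\<close>; \<open>a < r\<close> keeps the subtraction from truncating.\<close>
    have "even (r + a + (r - 1 - a)) \<longleftrightarrow> False"
      using a by (cases r) auto
    then have "(- 1 :: 'q) ^ (r + a) * (- 1) ^ (r - 1 - a) = - 1"
      unfolding power_add[symmetric] by simp
    then have minor: "(- 1) ^ (r + a) * minor J i (take a (j @ [k]) @ drop (Suc a) (j @ [k]))
      = - minor J i (j[a := k])"
      using minor_move_last[OF li lj a, of J k] a lj by (simp add: mult.assoc[symmetric])
    have u: "?u a = of_bool (l = j ! a)"
      using a lj l j nth_mem[of a j] by (auto simp: nth_append unit_vec_def)
    show "((- 1) ^ (r + a) * minor J i (take a (j @ [k]) @ drop (Suc a) (j @ [k]))) * ?u a
      = - (minor J i (j[a := k]) * of_bool (l = j ! a))" unfolding minor u by simp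
  qed
  finally show ?thesis by (simp add: sum_negf)
qed

text \<open>Cramer's rule as an equivalence: it shows that any solution has the stated entries,
  while the adjugate matrix provides a solution.\<close>

lemma col_mat_solve_iff:
  fixes J :: "'q::field mat"
  assumes li: "length i = r" and lj: "length j = r" and \<Delta>: "minor J i j \<noteq> 0"
    and q: "q \<in> carrier_vec r" and d: "d \<in> carrier_vec r"
  shows "col_mat J i j *\<^sub>v d = q \<longleftrightarrow> d = vec r (\<lambda>\<nu>. inverse (minor J i j) * col_form J i j \<nu> q)"
proof -
  let ?M = "col_mat J i j" and ?d = "vec r (\<lambda>\<nu>. inverse (minor J i j) * col_form J i j \<nu> q)"
  have M: "?M \<in> carrier_mat r r" by (rule col_mat_carrier[OF li lj])
  have det: "det ?M = minor J i j" using li lj by (simp add: minor_eq_det_col_mat)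
  have unique: "x = ?d" if x: "x \<in> carrier_vec r" "?M *\<^sub>v x = q" for x
  proof (rule eq_vecI)
    fix \<nu> assume "\<nu> < dim_vec ?d"
    then have "col_form J i j \<nu> q = x $ \<nu> * minor J i j"
      using cramer_lemma_mat[OF M x(1), of \<nu>] x det by (simp add: col_form_def col_mat_def)
    then show "x $ \<nu> = ?d $ \<nu>" using \<Delta> \<open>\<nu> < dim_vec ?d\<close> by simp
  qed (use x in auto)
  \<comment> \<open>This solution must equal \<open>?d\<close> by \<open>unique\<close>, hence
    \<open>?d\<close> is a solution too.\<close>
  let ?x = "inverse (minor J i j) \<cdot>\<^sub>v (adj_mat ?M *\<^sub>v q)"
  have adj: "adj_mat ?M \<in> carrier_mat r r" "?M * adj_mat ?M = det ?M \<cdot>\<^sub>m 1\<^sub>m r" using adj_mat[OF M] by auto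
  have x: "?x \<in> carrier_vec r" using adj q by auto
  have "?M *\<^sub>v ?x = inverse (minor J i j) \<cdot>\<^sub>v ((?M * adj_mat ?M) *\<^sub>v q)"
    using M adj(1) q by (simp add: mult_mat_vec)
  also have "\<dots> = inverse (minor J i j) \<cdot>\<^sub>v (minor J i j \<cdot>\<^sub>v q)"
    unfolding adj(2) det using q by (intro arg_cong2[of _ _ _ _ "(\<cdot>\<^sub>v)"] eq_vecI) auto
  also have "\<dots> = q" using \<Delta> q by (simp add: smult_smult_assoc)
  finally show ?thesis using unique[OF d] unique[OF x] by auto
qed

section \<open>Formal partial derivatives\<close>

subsection \<open>Derivations of a quotient of a polynomial ring\<close>

text \<open>The single case speaks only of keys of the given \<open>p\<close>, so a bound on the
  support stays available there. The rule serves both for polynomials and for exponent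
  vectors.\<close>

lemma poly_mapping_add_induct [case_names zero single add]:
  fixes p :: "'a \<Rightarrow>\<^sub>0 'b::comm_monoid_add"
  assumes "P 0" and "\<And>t. t \<in> Poly_Mapping.keys p \<Longrightarrow> P (Poly_Mapping.single t (Poly_Mapping.lookup p t))"
    and "\<And>p q. P p \<Longrightarrow> P q \<Longrightarrow> P (p + q)"
  shows "P p"
proof -
  have "P (\<Sum>t\<in>T. Poly_Mapping.single t (Poly_Mapping.lookup p t))"
    if "finite T" "T \<subseteq> Poly_Mapping.keys p" for T
    using that by (induction T) (use assms in auto)
  moreover have "(\<Sum>t\<in>Poly_Mapping.keys p. Poly_Mapping.single t (Poly_Mapping.lookup p t)) = p"
    by (rule poly_mapping_eqI) (auto simp: lookup_sum lookup_single when_def in_keys_iff)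
  ultimately show ?thesis by (metis finite_keys order_refl)
qed

text \<open>A coefficientwise formula frees \<open>pdiff\<close> from its sum over the support,
  which changes under addition.\<close>

lemma lookup_pdiff:
  "Poly_Mapping.lookup (pdiff j p) t =
    of_nat (Poly_Mapping.lookup t j + 1) * Poly_Mapping.lookup p (t + Poly_Mapping.single j 1)"
proof -
  let ?e = "Poly_Mapping.single j 1 :: nat \<Rightarrow>\<^sub>0 nat"
  have "Poly_Mapping.lookup (Poly_Mapping.single (s - ?e)
        (of_nat (Poly_Mapping.lookup s j) * Poly_Mapping.lookup p s)) t =
      (if s = t + ?e then of_nat (Poly_Mapping.lookup t j + 1) * Poly_Mapping.lookup p s else 0)" for s
  proof (cases "s = t + ?e")
    case False
    \<comment> \<open>Truncated subtraction can send another \<open>s\<close> to \<open>t\<close>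
      only when the exponent of \<open>s\<close> at \<open>j\<close> is 0, and then the factor
      \<open>of_nat\<close> kills the term.\<close>
    have "s - ?e = t \<Longrightarrow> Poly_Mapping.lookup s j = 0"
    proof (rule ccontr)
      assume *: "s - ?e = t" "Poly_Mapping.lookup s j \<noteq> 0"
      have "s = t + ?e"
        unfolding *(1)[symmetric] using *(2)
        by (intro poly_mapping_eqI) (auto simp: lookup_add lookup_minus lookup_single when_def)
      then show False using False by simp
    qed
    then show ?thesis using False by (auto simp: lookup_single when_def)
  qed (simp add: lookup_single lookup_add)
  then show ?thesis
    by (simp add: pdiff_def lookup_sum in_keys_iff)
qed

lemma pdiff_add: "pdiff j (p + q) = pdiff j p + pdiff j q"
  by (rule poly_mapping_eqI) (simp add: lookup_pdiff lookup_add distrib_left)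

lemma pdiff_0 [simp]: "pdiff j 0 = 0"
  by (simp add: pdiff_def)

lemma pdiff_uminus: "pdiff j (- p) = - pdiff j p"
  by (rule poly_mapping_eqI) (simp add: lookup_pdiff)

lemma pdiff_single:
  "pdiff j (Poly_Mapping.single s c) =
    Poly_Mapping.single (s - Poly_Mapping.single j 1) (of_nat (Poly_Mapping.lookup s j) * c)"
  by (cases "c = 0") (simp_all add: pdiff_def)

text \<open>For monomials the Leibniz rule is the additivity of the exponent at \<open>j\<close>.
  Truncation spoils the exponent arithmetic only where that exponent is 0, and there the coefficient
  vanishes.\<close>

lemma pdiff_mult_single:
  "pdiff j (Poly_Mapping.single s a * Poly_Mapping.single t b) =
    pdiff j (Poly_Mapping.single s a) * Poly_Mapping.single t b +
    Poly_Mapping.single s a * pdiff j (Poly_Mapping.single t b)"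
proof -
  let ?e = "Poly_Mapping.single j 1 :: nat \<Rightarrow>\<^sub>0 nat"
  have *: "s - ?e + t = s + t - ?e" if "Poly_Mapping.lookup s j \<noteq> 0" for s t :: "nat \<Rightarrow>\<^sub>0 nat"
    using that by (intro poly_mapping_eqI) (auto simp: lookup_add lookup_minus lookup_single when_def)
  have s: "Poly_Mapping.single (s - ?e + t) (of_nat (Poly_Mapping.lookup s j) * a * b) =
    Poly_Mapping.single (s + t - ?e) (of_nat (Poly_Mapping.lookup s j) * a * b)"
    using *[of s t] by (cases "Poly_Mapping.lookup s j = 0") auto
  have t: "Poly_Mapping.single (s + (t - ?e)) (a * (of_nat (Poly_Mapping.lookup t j) * b)) =
    Poly_Mapping.single (s + t - ?e) (a * (of_nat (Poly_Mapping.lookup t j) * b))"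
    using *[of t s] by (cases "Poly_Mapping.lookup t j = 0") (auto simp: add.commute)
  show ?thesis
    unfolding pdiff_single mult_single s t
    by (simp add: lookup_add single_add[symmetric] algebra_simps)
qed

lemma pdiff_mult: "pdiff j (p * q) = pdiff j p * q + p * pdiff j q"
proof (induction p rule: poly_mapping_add_induct)
  case (single s)
  then show ?case
    by (induction q rule: poly_mapping_add_induct)
      (simp_all add: pdiff_mult_single pdiff_add algebra_simps)
qed (simp_all add: pdiff_add algebra_simps)

lemma pdiff_Const [simp]: "pdiff j (Const c) = 0"
  by (simp add: Const_def pdiff_single)

lemma pdiff_Var: "pdiff j (Var l) = of_bool (j = l)"
  by (simp add: Var_def pdiff_single lookup_single when_def)

section \<open>The polynomial ring in finitely many variables\<close>

lemma poly_ring_simps [simp]: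
  "mult (poly_ring n) = (*)" "one (poly_ring n) = 1" "zero (poly_ring n) = 0" "add (poly_ring n) = (+)"
  by (simp_all add: poly_ring_def)

lemma mem_poly_ring:
  "p \<in> carrier (poly_ring n) \<longleftrightarrow> (\<forall>t\<in>Poly_Mapping.keys p. Poly_Mapping.keys t \<subseteq> {..<n})"
  by (simp add: poly_ring_def)

lemma poly_ring_add: "p \<in> carrier (poly_ring n) \<Longrightarrow> q \<in> carrier (poly_ring n) \<Longrightarrow> p + q \<in> carrier (poly_ring n)"
  using keys_add[of p q] by (fastforce simp: mem_poly_ring)

lemma poly_ring_mult: "p \<in> carrier (poly_ring n) \<Longrightarrow> q \<in> carrier (poly_ring n) \<Longrightarrow> p * q \<in> carrier (poly_ring n)"
  unfolding mem_poly_ring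
proof (intro ballI)
  assume pq: "\<forall>t\<in>Poly_Mapping.keys p. Poly_Mapping.keys t \<subseteq> {..<n}"
    "\<forall>t\<in>Poly_Mapping.keys q. Poly_Mapping.keys t \<subseteq> {..<n}"
  fix t assume "t \<in> Poly_Mapping.keys (p * q)"
  then obtain a b where "t = a + b" "a \<in> Poly_Mapping.keys p" "b \<in> Poly_Mapping.keys q"
    using keys_mult[of p q] by blast
  then show "Poly_Mapping.keys t \<subseteq> {..<n}" using pq keys_add[of a b] by blast
qed

lemma poly_ring_uminus: "p \<in> carrier (poly_ring n) \<Longrightarrow> - p \<in> carrier (poly_ring n)"
  by (simp add: mem_poly_ring in_keys_iff)

lemma poly_ring_0: "0 \<in> carrier (poly_ring n)" and poly_ring_1: "1 \<in> carrier (poly_ring n)"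
  by (simp_all add: mem_poly_ring)

lemma poly_ring_Const: "Const c \<in> carrier (poly_ring n)"
  by (simp add: mem_poly_ring Const_def)

lemma poly_ring_Var: "j < n \<Longrightarrow> Var j \<in> carrier (poly_ring n)"
  by (simp add: mem_poly_ring Var_def)

lemmas poly_ring_closed =
  poly_ring_add poly_ring_mult poly_ring_uminus poly_ring_0 poly_ring_1 poly_ring_Const poly_ring_Var

lemma poly_ring_sum: "(\<And>x. x \<in> X \<Longrightarrow> p x \<in> carrier (poly_ring n)) \<Longrightarrow> sum p X \<in> carrier (poly_ring n)"
  by (induction X rule: infinite_finite_induct) (auto intro: poly_ring_closed)

lemma poly_ring_pdiff:
  assumes "p \<in> carrier (poly_ring n)" shows "pdiff j p \<in> carrier (poly_ring n)"
  unfolding mem_poly_ring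
proof (intro ballI subsetI)
  fix t l assume "t \<in> Poly_Mapping.keys (pdiff j p)" and l: "l \<in> Poly_Mapping.keys t"
  then have "t + Poly_Mapping.single j 1 \<in> Poly_Mapping.keys p"
    by (auto simp: in_keys_iff lookup_pdiff)
  moreover have "l \<in> Poly_Mapping.keys (t + Poly_Mapping.single j 1)"
    using l by (simp add: in_keys_iff lookup_add)
  ultimately show "l \<in> {..<n}" using assms by (auto simp: mem_poly_ring)
qed

lemma cring_poly_ring: "cring (poly_ring n :: 'k::comm_ring_1 mpol ring)"
proof (rule cringI)
  show "abelian_group (poly_ring n :: 'k mpol ring)"
  proof (rule abelian_groupI)
    fix p :: "'k mpol" assume "p \<in> carrier (poly_ring n)"
    then show "\<exists>q\<in>carrier (poly_ring n). q \<oplus>\<^bsub>poly_ring n\<^esub> p = \<zero>\<^bsub>poly_ring n\<^esub>"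
      by (intro bexI[of _ "- p"]) (auto intro: poly_ring_closed)
  qed (auto intro: poly_ring_closed simp: algebra_simps)
  show "Group.comm_monoid (poly_ring n :: 'k mpol ring)"
    by (rule comm_monoidI) (auto intro: poly_ring_closed simp: algebra_simps)
qed (auto simp: algebra_simps)

text \<open>Multiplying by one variable at a time suits derivations: constants are governed by
  linearity over the base ring, a factor \<open>Var j\<close> by the Leibniz rule.\<close>

lemma poly_ring_induct [consumes 1, case_names Const Var_mult add]:
  assumes p: "p \<in> carrier (poly_ring n)" and Const: "\<And>c. P (Const c)"
    and Var: "\<And>j p. j < n \<Longrightarrow> p \<in> carrier (poly_ring n) \<Longrightarrow> P p \<Longrightarrow> P (Var j * p)"
    and add: "\<And>p q. p \<in> carrier (poly_ring n) \<Longrightarrow> q \<in> carrier (poly_ring n) \<Longrightarrow> P p \<Longrightarrow> P q \<Longrightarrow> P (p + q)"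
  shows "P p"
proof -
  let ?P = "\<lambda>p. p \<in> carrier (poly_ring n) \<and> P p"
  \<comment> \<open>Monomials act by induction on the exponent vector: powers of one variable first,
    then sums of exponents. Quantifying over \<open>p\<close> allows the two factors of a monomial
    to be applied in turn.\<close>
  have mono: "\<forall>p. ?P p \<longrightarrow> ?P (Poly_Mapping.single t 1 * p)"
    if t: "Poly_Mapping.keys t \<subseteq> {..<n}" for t
  proof (induction t rule: poly_mapping_add_induct)
    case zero
    show ?case by simp
  next
    case (single j)
    have "?P (Poly_Mapping.single (Poly_Mapping.single j k) 1 * p)" if "?P p" for p k
    proof (induction k)
      case (Suc k)
      have "Poly_Mapping.single (Poly_Mapping.single j (Suc k)) 1 * p =
          Var j * (Poly_Mapping.single (Poly_Mapping.single j k) 1 * p)"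
        by (simp add: Var_def mult.assoc[symmetric] mult_single single_add[symmetric])
      moreover have "j < n" using single t by auto
      ultimately show ?case using Suc Var by (auto intro: poly_ring_closed)
    qed (use that in simp)
    then show ?case by blast
  next
    case (add s t)
    have "(Poly_Mapping.single (s + t) 1 :: 'a mpol) = Poly_Mapping.single s 1 * Poly_Mapping.single t 1"
      by (simp add: mult_single)
    then show ?case using add by (simp only: mult.assoc) blast
  qed
  have "?P p"
  proof (induction p rule: poly_mapping_add_induct)
    case zero
    then show ?case using Const[of 0] by (simp add: Const_def poly_ring_0)
  next
    case (single t)
    have "?P (Poly_Mapping.single t 1 * Const (Poly_Mapping.lookup p t))"
    proof (rule mono[rule_format])
      show "Poly_Mapping.keys t \<subseteq> {..<n}" using single p by (simp add: mem_poly_ring)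
    qed (simp add: Const poly_ring_Const)
    then show ?case by (simp add: Const_def mult_single)
  next
    case (add p q)
    then show ?case using assms(4) poly_ring_add by blast
  qed
  then show ?thesis ..
qed

section \<open>The quotient ring, its embedding in a field, and its derivations\<close>

locale affine_quotient =
  fixes n :: nat and I :: "'k::comm_ring_1 mpol set" and \<iota> :: "'k mpol set \<Rightarrow> 'q::field"
  assumes ideal: "ideal I (poly_ring n)"
    and \<iota>: "\<iota> \<in> Ring.ring_hom (poly_ring n Quot I) class_ring" "inj_on \<iota> (carrier (poly_ring n Quot I))"
begin

sublocale ideal I "poly_ring n" by (rule ideal)

abbreviation "R \<equiv> poly_ring n :: 'k mpol ring"
abbreviation "A \<equiv> R Quot I"
abbreviation cls :: "'k mpol \<Rightarrow> 'k mpol set" where "cls p \<equiv> I +>\<^bsub>R\<^esub> p"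
abbreviation qval :: "'k mpol \<Rightarrow> 'q" where "qval p \<equiv> \<iota> (cls p)"

lemma carrier_A: "carrier A = cls ` carrier R"
  unfolding FactRing_def partial_object.simps A_RCOSETS_def' by blast

lemma cls_add: "p \<in> carrier R \<Longrightarrow> q \<in> carrier R \<Longrightarrow> cls p \<oplus>\<^bsub>A\<^esub> cls q = cls (p + q)"
  and cls_mult: "p \<in> carrier R \<Longrightarrow> q \<in> carrier R \<Longrightarrow> cls p \<otimes>\<^bsub>A\<^esub> cls q = cls (p * q)"
  using ring_hom_add[OF rcos_ring_hom] ring_hom_mult[OF rcos_ring_hom] by simp_all

lemma qval_add: "p \<in> carrier R \<Longrightarrow> q \<in> carrier R \<Longrightarrow> qval (p + q) = qval p + qval q"
  and qval_mult: "p \<in> carrier R \<Longrightarrow> q \<in> carrier R \<Longrightarrow> qval (p * q) = qval p * qval q"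
  using ring_hom_add[OF \<iota>(1)] ring_hom_mult[OF \<iota>(1)]
  by (simp_all add: carrier_A cls_add[symmetric] cls_mult[symmetric] class_ring_simps)

lemma qval_0: "qval 0 = 0"
  using qval_add[OF poly_ring_0 poly_ring_0] unfolding add_0_left add_cancel_right_left .

lemma qval_1: "qval 1 = 1"
  using ring_hom_one[OF \<iota>(1)] by (simp add: FactRing_simps class_ring_simps)

lemma qval_uminus: "p \<in> carrier R \<Longrightarrow> qval (- p) = - qval p"
  using qval_add[of p "- p"] qval_0 by (simp add: poly_ring_uminus eq_neg_iff_add_eq_0 add.commute)

lemma qval_sum:
  "(\<And>x. x \<in> X \<Longrightarrow> p x \<in> carrier R) \<Longrightarrow> qval (sum p X) = (\<Sum>x\<in>X. qval (p x))"
  by (induction X rule: infinite_finite_induct) (auto simp: qval_0 qval_add poly_ring_sum)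

text \<open>Injectivity of \<iota> lets cosets be compared in the field, so that calculations in the
  quotient become field arithmetic.\<close>

lemma qval_eq_iff: "p \<in> carrier R \<Longrightarrow> q \<in> carrier R \<Longrightarrow> qval p = qval q \<longleftrightarrow> cls p = cls q"
  using inj_onD[OF \<iota>(2)] by (auto simp: carrier_A)

lemma qval_eq_0_iff: "p \<in> carrier R \<Longrightarrow> qval p = 0 \<longleftrightarrow> p \<in> I"
  using qval_eq_iff[of p 0] by (metis qval_0 poly_ring_0 a_rcos_const a_rcos_self a_coset_add_zero poly_ring_simps(3) a_subset)

lemma qval_minus: "p \<in> carrier R \<Longrightarrow> q \<in> carrier R \<Longrightarrow> qval (p - q) = qval p - qval q"
  using qval_add[of p "- q"] by (simp add: qval_uminus poly_ring_uminus)

lemma cls_eq_iff: "p \<in> carrier R \<Longrightarrow> q \<in> carrier R \<Longrightarrow> cls p = cls q \<longleftrightarrow> p - q \<in> I"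
  using qval_eq_iff[of p q] qval_eq_0_iff[of "p - q"] qval_minus[of p q]
    poly_ring_add[of p n "- q"] poly_ring_uminus[of q n] by simp

text \<open>Both sides are additive in \<open>p\<close>, vanish on constants and obey the Leibniz
  rule for a factor \<open>Var l\<close>, so induction over the polynomial ring identifies
  them.\<close>

lemma derivation_chain_rule:
  assumes D: "D \<in> derivations (\<lambda>c. cls (Const c)) A" and p: "p \<in> carrier R"
  shows "\<iota> (D (cls p)) = (\<Sum>j<n. qval (pdiff j p) * \<iota> (D (cls (Var j))))"
proof -
  define d where "d p = \<iota> (D (cls p))" for p
  have Dc: "D x \<in> carrier A" if "x \<in> carrier A" for x
    using D that by (auto simp: derivations_def)
  have clsA: "cls p \<in> carrier A" if "p \<in> carrier R" for p using that by (auto simp: carrier_A)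
  have cA: "cls p \<in> carrier A" "D (cls p) \<in> carrier A" if "p \<in> carrier R" for p
    using clsA[OF that] Dc by auto
  note hom = ring_hom_add[OF \<iota>(1)] ring_hom_mult[OF \<iota>(1)]
  interpret A: ring A by (rule quotient_is_ring)
  have d_add: "d (p + q) = d p + d q" if pq: "p \<in> carrier R" "q \<in> carrier R" for p q
  proof -
    have "D (cls p \<oplus>\<^bsub>A\<^esub> cls q) = D (cls p) \<oplus>\<^bsub>A\<^esub> D (cls q)"
      using D cA pq by (auto simp: derivations_def)
    then show ?thesis using hom(1)[OF cA(2)[OF pq(1)] cA(2)[OF pq(2)]] pq
      by (simp add: d_def cls_add class_ring_simps)
  qed
  have d_mult: "d (p * q) = d p * qval q + qval p * d q" if pq: "p \<in> carrier R" "q \<in> carrier R" for p q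
  proof -
    have "D (cls p \<otimes>\<^bsub>A\<^esub> cls q) = (D (cls p) \<otimes>\<^bsub>A\<^esub> cls q) \<oplus>\<^bsub>A\<^esub> (cls p \<otimes>\<^bsub>A\<^esub> D (cls q))"
      using D cA pq by (auto simp: derivations_def)
    then show ?thesis
      using hom cA[OF pq(1)] cA[OF pq(2)] pq A.m_closed
      by (simp add: d_def cls_mult class_ring_simps)
  qed
  have d_scale: "d (Const c * p) = qval (Const c) * d p" if p: "p \<in> carrier R" for c p
  proof -
    have "D (cls (Const c) \<otimes>\<^bsub>A\<^esub> cls p) = cls (Const c) \<otimes>\<^bsub>A\<^esub> D (cls p)"
      using D cA p by (auto simp: derivations_def)
    then show ?thesis
      using hom(2)[OF cA(1)[OF poly_ring_Const] cA(2)[OF p]] p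
      by (simp add: d_def cls_mult class_ring_simps poly_ring_Const)
  qed
  \<comment> \<open>The Leibniz rule for \<open>1 * 1\<close> gives \<open>d 1 = 0\<close>, and
    linearity over the base ring carries this to all constants.\<close>
  have "d 1 = d 1 + d 1" using d_mult[OF poly_ring_1 poly_ring_1] by (simp only: qval_1 mult_1 mult_1_right)
  then have d1: "d 1 = 0" by (simp only: add_cancel_right_left)
  have dC: "d (Const c) = 0" for c using d_scale[OF poly_ring_1, of c] d1 by simp
  have "d p = (\<Sum>j<n. qval (pdiff j p) * d (Var j))"
    using p
  proof (induction p rule: poly_ring_induct)
    case (Const c)
    then show ?case by (simp add: dC qval_0)
  next
    case (Var_mult l p)
    have 1: "qval (pdiff j (Var l * p)) = of_bool (j = l) * qval p + qval (Var l) * qval (pdiff j p)" for j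
      using Var_mult
      by (cases "j = l")
        (simp_all add: pdiff_mult pdiff_Var qval_add qval_mult poly_ring_closed poly_ring_pdiff)
    have "(\<Sum>j<n. of_bool (j = l) * qval p * d (Var j)) = (\<Sum>j<n. if j = l then qval p * d (Var j) else 0)"
      by (rule sum.cong) auto
    also have "\<dots> = qval p * d (Var l)" using Var_mult.hyps by simp
    finally have "(\<Sum>j<n. of_bool (j = l) * qval p * d (Var j)) = qval p * d (Var l)" .
    moreover have "(\<Sum>j<n. qval (pdiff j (Var l * p)) * d (Var j)) =
        (\<Sum>j<n. of_bool (j = l) * qval p * d (Var j)) + qval (Var l) * (\<Sum>j<n. qval (pdiff j p) * d (Var j))"
      unfolding 1 by (simp only: distrib_right sum.distrib sum_distrib_left mult.assoc)
    ultimately show ?case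
      using Var_mult by (simp add: d_mult poly_ring_Var mult.commute)
  next
    case (add p q)
    then show ?case
      by (simp add: d_add pdiff_add qval_add poly_ring_pdiff distrib_right sum.distrib)
  qed
  then show ?thesis by (simp add: d_def)
qed

text \<open>The elements of \<open>I\<close> satisfying the equation form an ideal: for
  \<open>q\<close> in \<open>I\<close> the Leibniz terms of \<open>x * q\<close> that keep the
  factor \<open>q\<close> vanish in the quotient, leaving \<open>qval x\<close> times the sum for
  \<open>q\<close>. This ideal contains the generators, hence all of \<open>I\<close>.\<close>

lemma jacobi_kernel_vanishes_on_ideal:
  assumes I: "I = Idl\<^bsub>R\<^esub> (f ` {..<m})" and f: "\<And>s. s < m \<Longrightarrow> f s \<in> carrier R"
    and v: "\<And>s. s < m \<Longrightarrow> (\<Sum>j<n. qval (pdiff j (f s)) * v j) = 0"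
    and p: "p \<in> I"
  shows "(\<Sum>j<n. qval (pdiff j p) * v j) = 0"
proof -
  let ?K = "{p \<in> I. (\<Sum>j<n. qval (pdiff j p) * v j) = 0}"
  have IR: "q \<in> carrier R" if "q \<in> I" for q using that a_subset by auto
  have I0: "0 \<in> I" using additive_subgroup.zero_closed[OF additive_subgroup_axioms] by simp
  have I_add: "q + q' \<in> I" if "q \<in> I" "q' \<in> I" for q q'
    using additive_subgroup.a_closed[OF additive_subgroup_axioms that] by simp
  have I_mult: "x * q \<in> I" if "q \<in> I" "x \<in> carrier R" for x q using I_l_closed[OF that] by simp
  have K_mult: "x * q \<in> ?K" if "q \<in> ?K" "x \<in> carrier R" for x q
  proof -
    have q: "q \<in> I" "q \<in> carrier R" "qval q = 0" using that IR qval_eq_0_iff by auto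
    have "(\<Sum>j<n. qval (pdiff j (x * q)) * v j) = qval x * (\<Sum>j<n. qval (pdiff j q) * v j)"
      using that q by (simp add: pdiff_mult qval_add qval_mult poly_ring_closed poly_ring_pdiff
          sum_distrib_left[symmetric] mult.assoc)
    then show ?thesis using that I_mult by auto
  qed
  have neg: "- q \<in> ?K" if "q \<in> ?K" for q
    using K_mult[OF that poly_ring_uminus[OF poly_ring_1]] by simp
  have "ideal ?K R"
  proof (rule idealI)
    show "ring R" using cring_poly_ring cring.axioms(1) by blast
    show "subgroup ?K (add_monoid R)"
    proof
      show "inv\<^bsub>add_monoid R\<^esub> q \<in> ?K" if "q \<in> ?K" for q
      proof -
        have "\<ominus>\<^bsub>R\<^esub> q = - q"
          using that IR[of q] a_inv_def by (intro minus_equality) (auto intro: poly_ring_uminus)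
        then show ?thesis using neg[OF that] by (simp add: a_inv_def)
      qed
    qed (auto simp: I0 I_add pdiff_add qval_add qval_0 poly_ring_pdiff IR distrib_right sum.distrib)
    show "x \<otimes>\<^bsub>R\<^esub> q \<in> ?K" if "q \<in> ?K" "x \<in> carrier R" for x q
      using K_mult[OF that] by simp
    show "q \<otimes>\<^bsub>R\<^esub> x \<in> ?K" if "q \<in> ?K" "x \<in> carrier R" for x q
      using K_mult[OF that] by (simp add: mult.commute)
  qed
  moreover have "f ` {..<m} \<subseteq> I"
    unfolding I using f by (intro genideal_self) auto
  ultimately have "I \<subseteq> ?K" 
    using v genideal_minimal[of ?K "f ` {..<m}"] I by auto
  then show ?thesis using p by auto
qed

text \<open>A derivation kills the classes of the \<open>f s\<close>, which by the chain rule are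
  the Jacobi equations. Conversely, the entries of a kernel vector lift to polynomials
  \<open>g j\<close>, and the resulting derivation \<open>E\<close> of the polynomial ring preserves
  \<open>I\<close>, so it descends.\<close>

lemma der_expr_derivations:
  assumes I: "I = Idl\<^bsub>R\<^esub> (f ` {..<m})" and f: "\<And>s. s < m \<Longrightarrow> f s \<in> carrier R"
  shows "der_expr n I \<iota> ` derivations (\<lambda>c. cls (Const c)) A =
    {v \<in> carrier_vec n. (\<forall>j<n. v $ j \<in> \<iota> ` carrier A) \<and> jacobi m n I \<iota> f *\<^sub>v v = 0\<^sub>v m}"
    (is "_ ` ?Der = ?S")
proof (intro subset_antisym subsetI)
  have Jv: "jacobi m n I \<iota> f *\<^sub>v v = 0\<^sub>v m \<longleftrightarrow> (\<forall>s<m. (\<Sum>j<n. qval (pdiff j (f s)) * v $ j) = 0)"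
    if "v \<in> carrier_vec n" for v
    using that by (auto simp: vec_eq_iff jacobi_def scalar_prod_def lessThan_atLeast0)
  {
    fix v assume "v \<in> der_expr n I \<iota> ` ?Der"
    then obtain D where D: "D \<in> ?Der" and v: "v = der_expr n I \<iota> D" by auto
    have DA: "D x \<in> carrier A" if "x \<in> carrier A" for x
      using D that by (auto simp: derivations_def)
    have vj: "v $ j = \<iota> (D (cls (Var j)))" if "j < n" for j using that v by (simp add: der_expr_def)
    have "(\<Sum>j<n. qval (pdiff j (f s)) * v $ j) = 0" if s: "s < m" for s
    proof -
      have "f s \<in> I" unfolding I using f s genideal_self[of "f ` {..<m}"] by auto
      then have "cls (f s) = cls 0"
        using cls_eq_iff[OF f[OF s] poly_ring_0] by simp
      then have "\<iota> (D (cls (f s))) = \<iota> (D (cls 0))" by simp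
      also have "\<dots> = 0"
        using derivation_chain_rule[OF D poly_ring_0] by (simp add: qval_0)
      finally show ?thesis using derivation_chain_rule[OF D f[OF s]] vj by simp
    qed
    moreover have "v \<in> carrier_vec n" using v by (simp add: der_expr_def)
    moreover have "\<forall>j<n. v $ j \<in> \<iota> ` carrier A"
      using vj DA by (auto simp: carrier_A poly_ring_Var)
    ultimately show "v \<in> ?S" using Jv by auto
  }
  fix v assume v: "v \<in> ?S"
  then have "\<forall>j. \<exists>p. j < n \<longrightarrow> p \<in> carrier R \<and> v $ j = qval p" by (auto simp: carrier_A)
  then obtain g where g: "\<And>j. j < n \<Longrightarrow> g j \<in> carrier R" "\<And>j. j < n \<Longrightarrow> v $ j = qval (g j)" by metis
  define E where "E p = (\<Sum>j<n. pdiff j p * g j)" for p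
  have E_closed: "E p \<in> carrier R" if "p \<in> carrier R" for p
    unfolding E_def using that g by (auto intro!: poly_ring_sum poly_ring_closed poly_ring_pdiff)
  have E_add: "E (p + q) = E p + E q" for p q
    by (simp add: E_def pdiff_add distrib_right sum.distrib)
  have E_uminus: "E (- p) = - E p" for p
    by (simp add: E_def pdiff_uminus sum_negf)
  have E_mult: "E (p * q) = E p * q + p * E q" for p q
    by (simp add: E_def pdiff_mult sum.distrib sum_distrib_left sum_distrib_right algebra_simps)
  have E_scale: "E (Const c * p) = Const c * E p" for c p
    unfolding E_mult by (simp add: E_def)
  have E_Var: "E (Var j) = g j" if "j < n" for j
    using that by (simp add: E_def pdiff_Var of_bool_def if_distrib[of "\<lambda>x. x * _"] cong: if_cong)
  have E_I: "E p \<in> I" if "p \<in> I" for p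
  proof -
    have p: "p \<in> carrier R" using that a_subset by auto
    have "qval (E p) = (\<Sum>j<n. qval (pdiff j p) * v $ j)"
      unfolding E_def using p g by (subst qval_sum) (auto simp: qval_mult poly_ring_closed poly_ring_pdiff)
    also have "\<dots> = 0"
      using jacobi_kernel_vanishes_on_ideal[OF I f _ that] v Jv by auto
    finally show ?thesis using qval_eq_0_iff[OF E_closed[OF p]] by simp
  qed
  have E_cong: "cls (E p) = cls (E q)" if "p \<in> carrier R" "q \<in> carrier R" "cls p = cls q" for p q
  proof -
    have "E (p - q) = E p - E q" using E_add[of p "- q"] E_uminus by simp
    then show ?thesis using that E_I[of "p - q"] by (simp add: cls_eq_iff E_closed)
  qed
  \<comment> \<open>The value at a coset is read off from a chosen representative, which is harmless
    by \<open>E_cong\<close>; \<open>restrict\<close> gives the extensionality demanded by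
    \<open>derivations\<close>.\<close>
  define D where "D = restrict (\<lambda>X. cls (E (SOME p. p \<in> carrier R \<and> cls p = X))) (carrier A)"
  have D: "D (cls p) = cls (E p)" if p: "p \<in> carrier R" for p
  proof -
    let ?q = "SOME q. q \<in> carrier R \<and> cls q = cls p"
    have "?q \<in> carrier R \<and> cls ?q = cls p" by (rule someI[of _ p]) (use p in simp)
    then have "cls (E ?q) = cls (E p)" using p by (intro E_cong) auto
    moreover have "cls p \<in> carrier A" using p by (simp add: carrier_A)
    ultimately show ?thesis by (simp add: D_def)
  qed
  have "D \<in> ?Der"
    unfolding derivations_def
  proof (intro CollectI conjI ballI allI)
    show "D \<in> carrier A \<rightarrow>\<^sub>E carrier A"
    proof (rule PiE_I)
      show "D x \<in> carrier A" if "x \<in> carrier A" for x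
        using that D E_closed by (auto simp: carrier_A)
      show "D x = undefined" if "x \<notin> carrier A" for x
        using that by (simp add: D_def)
    qed
  next
    fix x y assume "x \<in> carrier A" "y \<in> carrier A"
    then obtain p q where pq: "p \<in> carrier R" "x = cls p" "q \<in> carrier R" "y = cls q"
      by (auto simp: carrier_A)
    show "D (x \<oplus>\<^bsub>A\<^esub> y) = D x \<oplus>\<^bsub>A\<^esub> D y"
      using pq by (simp add: cls_add D E_closed E_add poly_ring_add)
    show "D (x \<otimes>\<^bsub>A\<^esub> y) = (D x \<otimes>\<^bsub>A\<^esub> y) \<oplus>\<^bsub>A\<^esub> (x \<otimes>\<^bsub>A\<^esub> D y)"
      using pq by (simp add: cls_add cls_mult D E_closed E_mult poly_ring_closed)
  next
    fix c x assume "x \<in> carrier A"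
    then obtain p where p: "p \<in> carrier R" "x = cls p" by (auto simp: carrier_A)
    show "D (cls (Const c) \<otimes>\<^bsub>A\<^esub> x) = cls (Const c) \<otimes>\<^bsub>A\<^esub> D x"
      using p by (simp add: cls_mult D E_closed E_scale poly_ring_closed)
  qed
  moreover have "v = der_expr n I \<iota> D"
    using v g E_Var D by (intro eq_vecI) (auto simp: der_expr_def poly_ring_Var)
  ultimately show "v \<in> der_expr n I \<iota> ` ?Der" by blast
qed

end

section \<open>Solving for the pivot columns\<close>

subsection \<open>Kernel of a matrix with a distinguished nonsingular minor\<close>

locale nonsingular_minor =
  fixes J :: "'q::field mat" and m n r :: nat and i j :: "nat list"
  assumes J: "J \<in> carrier_mat m n" and i: "i \<in> index_tuples r m" and j: "j \<in> index_tuples r n"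
    and distinct: "distinct j" and nonsing: "minor J i j \<noteq> 0"
begin

abbreviation "\<Delta> \<equiv> minor J i j"
abbreviation "N \<equiv> {..<n} - set j"
abbreviation "w a \<equiv> finsum_vec TYPE('q) r (\<lambda>k. a k \<cdot>\<^sub>v col_vec J i k) N"
text \<open>By Cramer's rule these turn out to be the coordinates of \<open>w a\<close> in the basis
  of pivot columns, and \<open>expr a\<close> below the vector with entries \<open>a\<close> off the
  pivots and \<open>- coord a\<close> at the pivots.\<close>

abbreviation "coord a \<nu> \<equiv> inverse \<Delta> * col_form J i j \<nu> (w a)"
abbreviation "expr a \<equiv> finsum_vec TYPE('q) n (\<lambda>k. a k \<cdot>\<^sub>v unit_vec n k) N -
       inverse \<Delta> \<cdot>\<^sub>v finsum_vec TYPE('q) n (\<lambda>\<nu>. col_form J i j \<nu> (w a) \<cdot>\<^sub>v unit_vec n (j ! \<nu>)) {..<r}"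

lemma len [simp]: "length i = r" "length j = r"
  using i j by (auto simp: index_tuples_def)

lemma set_j: "set j = (!) j ` {..<r}"
  by (auto simp: set_conv_nth)

lemma j_less: "\<nu> < r \<Longrightarrow> j ! \<nu> < n"
  using j by (auto simp: index_tuples_def set_j)

lemma nth_j_eq_iff: "\<nu> < r \<Longrightarrow> \<mu> < r \<Longrightarrow> j ! \<nu> = j ! \<mu> \<longleftrightarrow> \<nu> = \<mu>"
  using nth_eq_iff_index_eq[OF distinct] by simp

lemma dim_finsum_unit_vec [simp]:
  "dim_vec (finsum_vec TYPE('q) n (\<lambda>k. b k \<cdot>\<^sub>v unit_vec n (g k)) S) = n"
  by (intro carrier_vecD finsum_vec_closed) auto

lemma index_w: "s < r \<Longrightarrow> w a $ s = (\<Sum>k\<in>N. a k * J $$ (i ! s, k))"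
  by (subst index_finsum_vec) (auto simp: col_vec_def)

lemma w_carrier: "w a \<in> carrier_vec r"
  by (rule finsum_vec_closed) (auto simp: col_vec_def)

text \<open>Linearity of the form in its column argument. It matches the left-hand sides of the two
  systems of inclusions.\<close>

lemma col_form_w:
  assumes "\<nu> < r"
  shows "col_form J i j \<nu> (w a) = (\<Sum>k\<in>N. minor J i (j[\<nu> := k]) * a k)"
proof -
  let ?c = "\<lambda>s. cofactor (col_mat J i j) s \<nu>"
  have "col_form J i j \<nu> (w a) = (\<Sum>s<r. \<Sum>k\<in>N. a k * (J $$ (i ! s, k) * ?c s))"
    using assms by (subst col_form_eq_sum_cofactor[where r = r])
      (auto simp: index_w sum_distrib_right mult.assoc)
  also have "\<dots> = (\<Sum>k\<in>N. \<Sum>s<r. a k * (J $$ (i ! s, k) * ?c s))"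
    by (rule sum.swap)
  also have "\<dots> = (\<Sum>k\<in>N. minor J i (j[\<nu> := k]) * a k)"
    using assms by (intro sum.cong refl)
      (simp add: minor_update_eq_col_form col_form_eq_sum_cofactor[where r = r] col_vec_def
        sum_distrib_left mult.commute)
  finally show ?thesis .
qed

lemma index_expr:
  assumes "l < n"
  shows "expr a $ l = (if l \<in> N then a l else 0) -
    inverse \<Delta> * (\<Sum>\<nu><r. col_form J i j \<nu> (w a) * of_bool (l = j ! \<nu>))"
proof -
  have "finsum_vec TYPE('q) n (\<lambda>k. a k \<cdot>\<^sub>v unit_vec n k) N $ l = (\<Sum>k\<in>N. if l = k then a k else 0)"
    using assms by (intro trans[OF index_finsum_vec] sum.cong) auto
  moreover have "finsum_vec TYPE('q) n (\<lambda>\<nu>. col_form J i j \<nu> (w a) \<cdot>\<^sub>v unit_vec n (j ! \<nu>)) {..<r} $ l =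
    (\<Sum>\<nu><r. col_form J i j \<nu> (w a) * of_bool (l = j ! \<nu>))"
    using assms j_less by (intro trans[OF index_finsum_vec] sum.cong) auto
  ultimately show ?thesis using assms by simp
qed

lemma expr_carrier: "expr a \<in> carrier_vec n"
  by (rule carrier_vecI) simp

lemma expr_free: "k \<in> N \<Longrightarrow> expr a $ k = a k"
  using set_j by (subst index_expr) (auto intro!: sum.neutral)

lemma expr_pivot:
  assumes "\<nu> < r" shows "expr a $ (j ! \<nu>) = - coord a \<nu>"
proof -
  have "(\<Sum>\<mu><r. col_form J i j \<mu> (w a) * of_bool (j ! \<nu> = j ! \<mu>)) =
      (\<Sum>\<mu><r. if \<nu> = \<mu> then col_form J i j \<mu> (w a) else 0)"
    using assms by (intro sum.cong refl) (auto simp: nth_j_eq_iff)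
  then show ?thesis
    using assms j_less set_j by (subst index_expr) auto
qed

text \<open>Compare coefficients: at a free column only the term with the full minor survives and
  cancels against \<open>inverse \<Delta>\<close>; at a pivot column, swapping the sums produces the
  form of \<open>w a\<close>. Hence both descriptions yield the same vector for every
  \<open>a\<close>.\<close>

lemma minor_der_sum_eq_expr:
  "inverse \<Delta> \<cdot>\<^sub>v finsum_vec TYPE('q) n (\<lambda>k. a k \<cdot>\<^sub>v minor_der J i (j @ [k])) N = expr a"
    (is "?l = _")
proof (rule eq_vecI)
  have mdc: "minor_der J i (j @ [k]) \<in> carrier_vec n" for k
    using J unfolding minor_der_def carrier_matD(2)[OF J] by (intro finsum_vec_closed) auto
  have c: "finsum_vec TYPE('q) n (\<lambda>k. a k \<cdot>\<^sub>v minor_der J i (j @ [k])) N \<in> carrier_vec n"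
    using mdc by (intro finsum_vec_closed) auto
  then show "dim_vec ?l = dim_vec (expr a)" by simp
  fix l assume "l < dim_vec (expr a)"
  then have l: "l < n" by simp
  have jn: "set j \<subseteq> {..<n}" using j by (simp add: index_tuples_def)
  have "(a k \<cdot>\<^sub>v minor_der J i (j @ [k])) $ l = a k * minor_der J i (j @ [k]) $ l" for k
    using l carrier_vecD[OF mdc[of k]] by (subst index_smult_vec) auto
  then have "?l $ l = inverse \<Delta> * (\<Sum>k\<in>N. a k * minor_der J i (j @ [k]) $ l)"
    using l mdc carrier_vecD[OF c] by (subst index_smult_vec, simp, subst index_finsum_vec) auto
  also have "\<dots> = inverse \<Delta> * (\<Sum>k\<in>N. (if l = k then a k * \<Delta> else 0) -
      (\<Sum>\<nu><r. minor J i (j[\<nu> := k]) * a k * of_bool (l = j ! \<nu>)))"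
  proof (intro arg_cong2[of _ _ _ _ "(*)"] sum.cong refl)
    fix k assume "k \<in> N"
    then have k: "k < n" by simp
    have "a k * (\<Sum>\<nu><r. minor J i (j[\<nu> := k]) * of_bool (l = j ! \<nu>)) =
        (\<Sum>\<nu><r. minor J i (j[\<nu> := k]) * a k * of_bool (l = j ! \<nu>))"
      by (simp only: sum_distrib_left mult_ac)
    then show "a k * minor_der J i (j @ [k]) $ l = (if l = k then a k * \<Delta> else 0) -
        (\<Sum>\<nu><r. minor J i (j[\<nu> := k]) * a k * of_bool (l = j ! \<nu>))"
      unfolding minor_der_snoc_index[OF len J jn k l] right_diff_distrib by simp
  qed
  also have "\<dots> = (if l \<in> N then a l else 0) -
      inverse \<Delta> * (\<Sum>k\<in>N. \<Sum>\<nu><r. minor J i (j[\<nu> := k]) * a k * of_bool (l = j ! \<nu>))"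
    using nonsing by (simp add: sum_subtractf right_diff_distrib)
  also have "\<dots> = expr a $ l"
    unfolding index_expr[OF l] by (subst sum.swap) (simp add: col_form_w sum_distrib_right)
  finally show "?l $ l = expr a $ l" .
qed

lemma sum_columns: "(\<Sum>l<n. h l) = (\<Sum>\<mu><r. h (j ! \<mu>)) + (\<Sum>k\<in>N. h k)"
proof -
  have "(\<Sum>l<n. h l) = (\<Sum>l\<in>set j. h l) + (\<Sum>k\<in>N. h k)"
    using j by (subst add.commute, intro sum.subset_diff) (auto simp: index_tuples_def)
  also have "(\<Sum>l\<in>set j. h l) = (\<Sum>\<mu><r. h (j ! \<mu>))"
    unfolding set_j by (subst sum.reindex) (auto simp: inj_on_def nth_j_eq_iff)
  finally show ?thesis .
qed

text \<open>Separating pivot from free columns turns the row equations into a square system for the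
  pivot entries with right-hand side \<open>w (($) v)\<close>, which Cramer's rule solves.\<close>

lemma rows_kernel_iff:
  "(\<forall>s<r. (\<Sum>l<n. J $$ (i ! s, l) * v $ l) = 0) \<longleftrightarrow> (\<forall>\<nu><r. v $ (j ! \<nu>) = - coord (($) v) \<nu>)"
proof -
  \<comment> \<open>The pivot entries are negated because they move to the other side of the
    equations.\<close>
  let ?d = "vec r (\<lambda>\<mu>. - v $ (j ! \<mu>))"
  have "(\<Sum>l<n. J $$ (i ! s, l) * v $ l) = w (($) v) $ s - (col_mat J i j *\<^sub>v ?d) $ s" if "s < r" for s
    using that by (simp add: sum_columns index_w scalar_prod_def col_mat_index sum_negf
        lessThan_atLeast0[symmetric] mult.commute)
  then have "(\<forall>s<r. (\<Sum>l<n. J $$ (i ! s, l) * v $ l) = 0) \<longleftrightarrow> col_mat J i j *\<^sub>v ?d = w (($) v)"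
    using w_carrier[of "($) v"] by (auto simp: vec_eq_iff)
  moreover have "col_mat J i j *\<^sub>v ?d = w (($) v) \<longleftrightarrow> (\<forall>\<nu><r. - v $ (j ! \<nu>) = coord (($) v) \<nu>)"
    by (subst col_mat_solve_iff[OF len nonsing w_carrier]) (auto simp: vec_eq_iff)
  moreover have "- x = y \<longleftrightarrow> x = - y" for x y :: 'q by auto
  ultimately show ?thesis by simp
qed

text \<open>The free entries parametrize the kernel, and membership of the pivot entries in
  \<open>AQ\<close> becomes the condition on \<open>coord\<close>. Closure under negation absorbs
  the sign between the two.\<close>

lemma kernel_vectors_eq_exprs:
  assumes r: "r = vec_space.rank m J" and rows: "i \<in> nonsing_rows J r"
    and uminus: "\<And>x. x \<in> AQ \<Longrightarrow> - x \<in> AQ"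
  shows "{v \<in> carrier_vec n. (\<forall>l<n. v $ l \<in> AQ) \<and> J *\<^sub>v v = 0\<^sub>v m} =
    {expr a | a. (\<forall>k\<in>N. a k \<in> AQ) \<and> (\<forall>\<nu><r. coord a \<nu> \<in> AQ)}"
proof (intro subset_antisym subsetI)
  have ker: "J *\<^sub>v v = 0\<^sub>v m \<longleftrightarrow> (\<forall>\<nu><r. v $ (j ! \<nu>) = - coord (($) v) \<nu>)" if "v \<in> carrier_vec n" for v
    using mult_vec_eq_0_iff_nonsing_rows[OF J r rows that] rows_kernel_iff by simp
  have cases: "P l" if "l < n" "\<And>k. k \<in> N \<Longrightarrow> P k" "\<And>\<nu>. \<nu> < r \<Longrightarrow> P (j ! \<nu>)" for P l
    using that set_j by (cases "l \<in> set j") auto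
  {
    fix v assume "v \<in> {v \<in> carrier_vec n. (\<forall>l<n. v $ l \<in> AQ) \<and> J *\<^sub>v v = 0\<^sub>v m}"
    then have v: "v \<in> carrier_vec n" "\<And>l. l < n \<Longrightarrow> v $ l \<in> AQ" "\<And>\<nu>. \<nu> < r \<Longrightarrow> v $ (j ! \<nu>) = - coord (($) v) \<nu>"
      using ker by auto
    have "v = expr (($) v)"
    proof (rule eq_vecI)
      fix l assume "l < dim_vec (expr (($) v))"
      then have "l < n" by simp
      then show "v $ l = expr (($) v) $ l"
        by (rule cases[where P = "\<lambda>l. v $ l = expr (($) v) $ l"]) (use v(3) expr_free expr_pivot in auto)
    qed (use v(1) in simp)
    moreover have "coord (($) v) \<nu> \<in> AQ" if "\<nu> < r" for \<nu>
      using uminus[OF v(2)[OF j_less[OF that]]] v(3)[OF that] by simp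
    ultimately show "v \<in> {expr a | a. (\<forall>k\<in>N. a k \<in> AQ) \<and> (\<forall>\<nu><r. coord a \<nu> \<in> AQ)}"
      using v(2) by blast
  }
  fix v assume "v \<in> {expr a | a. (\<forall>k\<in>N. a k \<in> AQ) \<and> (\<forall>\<nu><r. coord a \<nu> \<in> AQ)}"
  then obtain a where a: "v = expr a" "\<And>k. k \<in> N \<Longrightarrow> a k \<in> AQ" "\<And>\<nu>. \<nu> < r \<Longrightarrow> coord a \<nu> \<in> AQ" by auto
  have v: "v \<in> carrier_vec n" using a(1) expr_carrier by simp
  have free: "v $ k = a k" if "k \<in> N" for k using that a(1) expr_free by simp
  have pivot: "v $ (j ! \<nu>) = - coord a \<nu>" if "\<nu> < r" for \<nu> using that a(1) expr_pivot by simp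
  have "J *\<^sub>v v = 0\<^sub>v m"
    unfolding ker[OF v]
  proof (intro allI impI)
    fix \<nu> assume \<nu>: "\<nu> < r"
    \<comment> \<open>\<open>w\<close> involves only the free entries, where \<open>v\<close> agrees
      with \<open>a\<close>.\<close>
    have "col_form J i j \<nu> (w (($) v)) = col_form J i j \<nu> (w a)"
      unfolding col_form_w[OF \<nu>] using free by simp
    then show "v $ (j ! \<nu>) = - coord (($) v) \<nu>" unfolding pivot[OF \<nu>] by (simp only:)
  qed
  moreover have "v $ l \<in> AQ" if "l < n" for l
    by (rule cases[OF that]) (use a free pivot uminus in auto)
  ultimately show "v \<in> {v \<in> carrier_vec n. (\<forall>l<n. v $ l \<in> AQ) \<and> J *\<^sub>v v = 0\<^sub>v m}"
    using v by auto
qed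

text \<open>The geometric meaning: a combination of the pivot columns is
  \<open>col_mat J i j\<close> applied to its coefficients, so Cramer's rule gives existence and
  uniqueness of the coordinates.\<close>

lemma w_eq_combination_iff:
  assumes d: "d \<in> carrier_vec r"
  shows "w a = finsum_vec TYPE('q) r (\<lambda>\<nu>. d $ \<nu> \<cdot>\<^sub>v col_vec J i (j ! \<nu>)) {..<r} \<longleftrightarrow> d = vec r (coord a)"
proof -
  have "finsum_vec TYPE('q) r (\<lambda>\<nu>. d $ \<nu> \<cdot>\<^sub>v col_vec J i (j ! \<nu>)) {..<r} = col_mat J i j *\<^sub>v d" (is "?s = _")
  proof (rule eq_vecI)
    fix s assume "s < dim_vec (col_mat J i j *\<^sub>v d)"
    then have s: "s < r" by simp
    then have "?s $ s = (\<Sum>\<nu><r. d $ \<nu> * J $$ (i ! s, j ! \<nu>))"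
      by (subst index_finsum_vec) (auto simp: col_vec_def)
    then show "?s $ s = (col_mat J i j *\<^sub>v d) $ s"
      using s d by (simp add: scalar_prod_def col_mat_index lessThan_atLeast0[symmetric] mult.commute)
  next
    have "?s \<in> carrier_vec r" by (intro finsum_vec_closed) (auto simp: col_vec_def)
    then show "dim_vec ?s = dim_vec (col_mat J i j *\<^sub>v d)" by simp
  qed
  then show ?thesis
    using col_mat_solve_iff[OF len nonsing w_carrier d, of a] by auto
qed

lemma mem_multiples_iff: "x \<in> {b * \<Delta> | b. b \<in> AQ} \<longleftrightarrow> inverse \<Delta> * x \<in> AQ"
proof
  assume "inverse \<Delta> * x \<in> AQ"
  moreover have "x = inverse \<Delta> * x * \<Delta>" using nonsing by simp
  ultimately show "x \<in> {b * \<Delta> | b. b \<in> AQ}" by blast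
next
  assume "x \<in> {b * \<Delta> | b. b \<in> AQ}"
  then obtain b where "b \<in> AQ" "x = b * \<Delta>" by blast
  then show "inverse \<Delta> * x \<in> AQ" using nonsing by (simp add: mult.left_commute[of _ b])
qed

end

section \<open>The two descriptions of the derivations and the meaning of the inclusions\<close>

theorem theorem2p12:
  fixes n m r :: nat
    and f :: "nat \<Rightarrow> 'k::field_char_0 mpol"
    and I :: "'k mpol set"
    and A :: "'k mpol set ring"
    and \<iota> :: "'k mpol set \<Rightarrow> 'q::field"
    and AQ :: "'q set"
    and Der :: "('k mpol set \<Rightarrow> 'k mpol set) set"
    and J :: "'q mat"
    and i j :: "nat list"
    and N :: "nat set"
    and w :: "(nat \<Rightarrow> 'q) \<Rightarrow> 'q vec"
  assumes f: "\<And>s. s < m \<Longrightarrow> f s \<in> carrier (poly_ring n)"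
    and I: "I = Idl\<^bsub>poly_ring n\<^esub> (f ` {..<m})"
    and prime: "primeideal I (poly_ring n)"
    and not_maximal: "\<not> maximalideal I (poly_ring n)"
    and A: "A = poly_ring n Quot I"
    and Q: "is_fraction_field A \<iota>"
    and AQ: "AQ = \<iota> ` carrier A"
    and Der: "Der = derivations (\<lambda>c. I +>\<^bsub>poly_ring n\<^esub> Const c) A"
    and J: "J = jacobi m n I \<iota> f"
    and r: "r = vec_space.rank m J"
    and i: "i \<in> nonsing_rows J r"
    and j: "j \<in> nonsing_cols J r"
    and N: "N = {..<n} - set j"
    and w: "w = (\<lambda>a. finsum_vec TYPE('q) r (\<lambda>k. a k \<cdot>\<^sub>v col_vec J i k) N)"
  shows
    "der_expr n I \<iota> ` Der =
      {inverse (minor J i j) \<cdot>\<^sub>v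
         finsum_vec TYPE('q) n (\<lambda>k. a k \<cdot>\<^sub>v minor_der J i (j @ [k])) N | a.
       (\<forall>k \<in> N. a k \<in> AQ) \<and>
       (\<forall>\<nu><r. (\<Sum>k\<in>N. minor J i (j[\<nu> := k]) * a k) \<in> {b * minor J i j | b. b \<in> AQ})}
    \<and>
    der_expr n I \<iota> ` Der =
      {finsum_vec TYPE('q) n (\<lambda>k. a k \<cdot>\<^sub>v unit_vec n k) N -
       inverse (minor J i j) \<cdot>\<^sub>v
         finsum_vec TYPE('q) n (\<lambda>\<nu>. col_form J i j \<nu> (w a) \<cdot>\<^sub>v unit_vec n (j ! \<nu>)) {..<r} | a.
       (\<forall>k \<in> N. a k \<in> AQ) \<and>
       (\<forall>\<nu><r. inverse (minor J i j) * col_form J i j \<nu> (w a) \<in> AQ)}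
    \<and>
    (\<forall>a. (\<forall>k \<in> N. a k \<in> AQ) \<longrightarrow>
      (\<exists>c \<in> carrier_vec r.
        (\<forall>d \<in> carrier_vec r.
          w a = finsum_vec TYPE('q) r (\<lambda>\<nu>. d $ \<nu> \<cdot>\<^sub>v col_vec J i (j ! \<nu>)) {..<r} \<longleftrightarrow> d = c) \<and>
        ((\<forall>\<nu><r. (\<Sum>k\<in>N. minor J i (j[\<nu> := k]) * a k) \<in> {b * minor J i j | b. b \<in> AQ})
           \<longleftrightarrow> (\<forall>\<nu><r. c $ \<nu> \<in> AQ)) \<and>
        ((\<forall>\<nu><r. inverse (minor J i j) * col_form J i j \<nu> (w a) \<in> AQ)
           \<longleftrightarrow> (\<forall>\<nu><r. c $ \<nu> \<in> AQ))))"
proof -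
  have idl: "ideal I (poly_ring n)" using prime by (rule primeideal.axioms)
  interpret affine_quotient n I \<iota>
    using Q by (intro affine_quotient.intro[OF idl]) (auto simp: is_fraction_field_def A)
  have Jc: "J \<in> carrier_mat m n" by (simp add: J jacobi_def)
  have uminus: "- x \<in> AQ" if x: "x \<in> AQ" for x
  proof -
    obtain p where p: "p \<in> carrier (poly_ring n)" "x = \<iota> (I +>\<^bsub>poly_ring n\<^esub> p)"
      using x by (auto simp: AQ A carrier_A)
    then have "- x = \<iota> (I +>\<^bsub>poly_ring n\<^esub> (- p))" by (simp add: qval_uminus)
    then show ?thesis using poly_ring_uminus[OF p(1)] by (auto simp: AQ A carrier_A)
  qed
  interpret M: nonsingular_minor J m n r i j
  proof
    show "minor J i j \<noteq> 0" by (rule nonsing_minor_ne_0[OF Jc r i j])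
    show "distinct j" using j by (auto simp: nonsing_cols_def strict_sorted_iff)
  qed (use i j Jc in \<open>auto simp: nonsing_rows_def nonsing_cols_def\<close>)
  have "der_expr n I \<iota> ` Der = {v \<in> carrier_vec n. (\<forall>l<n. v $ l \<in> AQ) \<and> J *\<^sub>v v = 0\<^sub>v m}"
    unfolding Der AQ A J by (rule der_expr_derivations[OF I f])
  also have "\<dots> = {M.expr a | a. (\<forall>k\<in>N. a k \<in> AQ) \<and> (\<forall>\<nu><r. M.coord a \<nu> \<in> AQ)}"
    unfolding N by (rule M.kernel_vectors_eq_exprs[OF r i uminus])
  finally have Der_eq: "der_expr n I \<iota> ` Der =
      {M.expr a | a. (\<forall>k\<in>N. a k \<in> AQ) \<and> (\<forall>\<nu><r. M.coord a \<nu> \<in> AQ)}" .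
  have inclusions: "(\<Sum>k\<in>N. minor J i (j[\<nu> := k]) * a k) \<in> {b * minor J i j | b. b \<in> AQ} \<longleftrightarrow>
      M.coord a \<nu> \<in> AQ" if "\<nu> < r" for a \<nu>
    unfolding N M.col_form_w[OF that] by (rule M.mem_multiples_iff)
  have all_inclusions: "(\<forall>\<nu><r. (\<Sum>k\<in>N. minor J i (j[\<nu> := k]) * a k) \<in> {b * minor J i j | b. b \<in> AQ}) \<longleftrightarrow>
      (\<forall>\<nu><r. M.coord a \<nu> \<in> AQ)" for a
    using inclusions by blast
  show ?thesis
    \<comment> \<open>The divisibility conditions are rewritten while \<open>N\<close> is still
      folded, as in \<open>all_inclusions\<close>; afterwards both systems are the same condition on
      \<open>M.coord\<close>.\<close>
    unfolding all_inclusions unfolding w unfolding N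
  proof (intro conjI allI impI)
    show "der_expr n I \<iota> ` Der = {inverse (minor J i j) \<cdot>\<^sub>v
         finsum_vec TYPE('q) n (\<lambda>k. a k \<cdot>\<^sub>v minor_der J i (j @ [k])) M.N | a.
       (\<forall>k \<in> M.N. a k \<in> AQ) \<and> (\<forall>\<nu><r. M.coord a \<nu> \<in> AQ)}"
      unfolding M.minor_der_sum_eq_expr using Der_eq unfolding N .
    show "der_expr n I \<iota> ` Der = {M.expr a | a. (\<forall>k\<in>M.N. a k \<in> AQ) \<and> (\<forall>\<nu><r. M.coord a \<nu> \<in> AQ)}"
      using Der_eq unfolding N .
    fix a
    show "\<exists>c\<in>carrier_vec r.
        (\<forall>d\<in>carrier_vec r. M.w a = finsum_vec TYPE('q) r (\<lambda>\<nu>. d $ \<nu> \<cdot>\<^sub>v col_vec J i (j ! \<nu>)) {..<r} \<longleftrightarrow> d = c) \<and>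
        ((\<forall>\<nu><r. M.coord a \<nu> \<in> AQ) \<longleftrightarrow> (\<forall>\<nu><r. c $ \<nu> \<in> AQ)) \<and>
        ((\<forall>\<nu><r. M.coord a \<nu> \<in> AQ) \<longleftrightarrow> (\<forall>\<nu><r. c $ \<nu> \<in> AQ))"
      \<comment> \<open>The witness is the vector of Cramer coordinates, so both equivalences hold
        entry by entry.\<close>
      by (intro bexI[of _ "vec r (M.coord a)"]) (simp_all add: M.w_eq_combination_iff)
  qed
qed

end
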